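(* Let $r\ge 3$ be an integer, let $G$ be any $\{C_{1r},C^*\}$-free linear $r$-graph on $n$ vertices, and let $s$ denote the number of vertices of $G$ with degree at least $(r-1)^2+2$. Then $$|E(G)|\le \frac{r(r-2)(n-s)}{r-1}.$$
   Context: An $r$-graph $H=(V,E)$ consists of a (finite, nonempty) vertex set $V=V(H)$ and a collection $E=E(H)$ of $r$-element subsets of $V$, called edges. It is linear if any two distinct edges intersect in at most one vertex. The degree $d(v)$ of a vertex $v$ is the number of edges containing $v$. For linear $r$-graphs $F_1,F_2$, an $r$-graph $H$ is $\{F_1,F_2\}$-free if it contains no copy of $F_1$ and no copy of $F_2$ as a (not necessarily induced) subhypergraph. The $r$-crown $C_{1r}$ is the linear $r$-graph on $r^2$ vertices with $r+1$ edges obtained from $r$ pairwise disjoint edges by adding one edge that intersects each of them in exactly one vertex. $C^*$ is the linear $r$-graph on $r^2-r+3$ vertices with $r+1$ edges $e_1,\dots,e_r,e$ such that: the $r-2$ edges $e_1,\dots,e_{r-2}$ all contain a common vertex $v$ and are otherwise pairwise disjoint (for $r=3$ there is just one such edge $e_1$, with $v$ a vertex of it); the edges $e_{r-1}$ and $e_r$ are disjoint from each other and from each of $e_1,\dots,e_{r-2}$; and the edge $e$ does not contain $v$ and intersects each of $e_1,\dots,e_r$ in exactly one vertex. *)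

theory Defs
  imports Complex_Main
begin

type_synonym 'a hypergraph = "'a set \<times> 'a set set"

abbreviation verts :: "'a hypergraph \<Rightarrow> 'a set" where "verts \<equiv> fst"

abbreviation edges :: "'a hypergraph \<Rightarrow> 'a set set" where "edges \<equiv> snd"

definition r_graph :: "nat \<Rightarrow> 'a hypergraph \<Rightarrow> bool" where
  "r_graph r H \<longleftrightarrow> finite (verts H) \<and> verts H \<noteq> {} \<and>
     (\<forall>e\<in>edges H. e \<subseteq> verts H \<and> card e = r)"

definition linear_hypergraph :: "'a hypergraph \<Rightarrow> bool" where
  "linear_hypergraph H \<longleftrightarrow>
     (\<forall>e\<in>edges H. \<forall>f\<in>edges H. e \<noteq> f \<longrightarrow> card (e \<inter> f) \<le> 1)"

definition degree :: "'a hypergraph \<Rightarrow> 'a \<Rightarrow> nat" where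
  "degree H v = card {e \<in> edges H. v \<in> e}"

definition contains_copy :: "'a hypergraph \<Rightarrow> 'b hypergraph \<Rightarrow> bool" where
  "contains_copy H F \<longleftrightarrow>
     (\<exists>\<phi>. inj_on \<phi> (verts F) \<and> \<phi> ` verts F \<subseteq> verts H \<and> (\<forall>e\<in>edges F. \<phi> ` e \<in> edges H))"

definition free_of :: "'b hypergraph set \<Rightarrow> 'a hypergraph \<Rightarrow> bool" where
  "free_of \<F> H \<longleftrightarrow> (\<forall>F\<in>\<F>. \<not> contains_copy H F)"

text \<open>The \<open>r\<close>-crown on an \<open>r \<times> r\<close> grid: the rows are the pairwise disjoint edges and column
  \<open>0\<close> is the additional edge.\<close>

definition crown :: "nat \<Rightarrow> (nat \<times> nat) hypergraph" where
  "crown r =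
     ({..<r} \<times> {..<r},
      insert ({..<r} \<times> {0}) ((\<lambda>i. {i} \<times> {..<r}) ` {..<r}))"

text \<open>The hypergraph \<open>C\<^sup>*\<close> on the same grid, with rows \<open>0, \<dots>, r - 1\<close> as the edges
  \<open>e\<^sub>1, \<dots>, e\<^sub>r\<close>: the first \<open>r - 2\<close> rows have their column-\<open>0\<close> cells identified to the
  single vertex \<open>v = (0, 0)\<close>, the last two rows are unchanged, and column \<open>1\<close>, which misses
  \<open>v\<close>, is the edge \<open>e\<close>.\<close>

definition c_star :: "nat \<Rightarrow> (nat \<times> nat) hypergraph" where
  "c_star r =
     (insert (0, 0) ({..<r - 2} \<times> {1..<r}) \<union> {r - 2..<r} \<times> {..<r},
      insert ({..<r} \<times> {1})
        ((\<lambda>i. insert (0, 0) ({i} \<times> {1..<r})) ` {..<r - 2} \<union>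
         (\<lambda>i. {i} \<times> {..<r}) ` {r - 2..<r}))"

lemma crown_r_graph:
  assumes "r \<ge> 3" shows "r_graph r (crown r)"
proof -
  have "(0, 0) \<in> {..<r} \<times> {..<r}" using assms by simp
  then have "{..<r} \<times> {..<r} \<noteq> {}" by blast
  then show ?thesis using assms by (auto simp: r_graph_def crown_def)
qed

lemma card_verts_crown: "card (verts (crown r)) = r\<^sup>2"
  by (simp add: crown_def power2_eq_square)

lemma card_le_1I:
  assumes "\<And>x y. x \<in> X \<Longrightarrow> y \<in> X \<Longrightarrow> x = y" shows "card X \<le> 1"
proof (cases "X = {}")
  case False
  then obtain x where "X = {x}" using assms by blast
  then show ?thesis by simp
qed simp

lemma crown_linear: "linear_hypergraph (crown r)"
  unfolding linear_hypergraph_def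
  by (intro ballI impI card_le_1I) (auto simp: crown_def)

lemma card_edges_crown:
  assumes "r \<ge> 3" shows "card (edges (crown r)) = r + 1"
proof -
  have inj: "inj_on (\<lambda>i. {i} \<times> {..<r}) {..<r}"
    using assms by (auto simp: inj_on_def set_eq_iff)
  have "({..<r} \<times> {0}) \<notin> (\<lambda>i. {i} \<times> {..<r}) ` {..<r}"
  proof
    assume "({..<r} \<times> {0}) \<in> (\<lambda>i. {i} \<times> {..<r}) ` {..<r}"
    then obtain i where "{..<r} \<times> {0} = {i} \<times> {..<r}" by auto
    moreover have "(0, 0) \<in> {..<r} \<times> {0::nat}" "(1, 0) \<in> {..<r} \<times> {0::nat}" using assms by auto
    ultimately show False by auto
  qed
  then show ?thesis by (simp add: crown_def card_image[OF inj])
qed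

lemma c_star_r_graph:
  assumes "r \<ge> 3" shows "r_graph r (c_star r)"
  using assms by (auto simp: r_graph_def c_star_def)

lemma card_verts_c_star:
  assumes "r \<ge> 3" shows "card (verts (c_star r)) = r\<^sup>2 - r + 3"
proof -
  obtain k where r: "r = k + 3" using assms by (metis add.commute le_Suc_ex)
  have "card (insert (0, 0) ({..<r - 2} \<times> {1..<r}) \<union> {r - 2..<r} \<times> {..<r}) =
      card (insert (0, 0) ({..<r - 2} \<times> {1..<r})) + card ({r - 2..<r} \<times> {..<r})"
    by (rule card_Un_disjoint) (use assms in auto)
  then show ?thesis
    by (simp add: c_star_def r power2_eq_square algebra_simps)
qed

lemma card_edges_c_star:
  assumes "r \<ge> 3" shows "card (edges (c_star r)) = r + 1"
proof -
  let ?A = "(\<lambda>i. insert (0, 0) ({i} \<times> {1..<r})) ` {..<r - 2}"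
  let ?B = "(\<lambda>i. {i} \<times> {..<r}) ` {r - 2..<r}"
  have A: "inj_on (\<lambda>i. insert (0, 0) ({i} \<times> {1..<r})) {..<r - 2}"
  proof (rule inj_onI)
    fix i j assume "insert (0, 0) ({i} \<times> {1..<r}) = insert (0, 0) ({j} \<times> {1..<r})"
    moreover have "(i, 1) \<in> insert (0, 0) ({i} \<times> {1..<r})" using assms by auto
    ultimately show "i = j" by auto
  qed
  have B: "inj_on (\<lambda>i. {i} \<times> {..<r}) {r - 2..<r}"
    using assms by (auto simp: inj_on_def times_eq_iff)
  have AB: "?A \<inter> ?B = {}"
  proof (rule equals0I)
    fix X assume "X \<in> ?A \<inter> ?B"
    then have "X \<in> ?A" "X \<in> ?B" by blast+
    from this(1) obtain i where i: "X = insert (0, 0) ({i} \<times> {1..<r})" "i < r - 2"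
      by (elim imageE) simp
    from \<open>X \<in> ?B\<close> obtain j where j: "X = {j} \<times> {..<r}" "r - 2 \<le> j" by (elim imageE) simp
    have "(i, 1) \<in> X" unfolding i(1) using assms by auto
    then show False using i(2) j(2) unfolding j(1) by auto
  qed
  have e: "({..<r} \<times> {1}) \<notin> ?A \<union> ?B"
  proof
    assume "({..<r} \<times> {1}) \<in> ?A \<union> ?B"
    then consider i where "{..<r} \<times> {1} = insert (0, 0) ({i} \<times> {1..<r})"
      | i where "{..<r} \<times> {1} = {i} \<times> {..<r}" by blast
    then obtain i :: nat where "(i, 2) \<in> {..<r} \<times> {1::nat}"
    proof cases
      case (1 i)
      then show ?thesis using assms that[of i] by simp
    next
      case (2 i)
      then show ?thesis using assms that[of i] by simp
    qed
    then show False by simp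
  qed
  have "card (?A \<union> ?B) = r"
    using card_Un_disjoint[OF _ _ AB] assms card_image[OF A] card_image[OF B] by simp
  then show ?thesis using e by (simp add: c_star_def)
qed

lemma c_star_linear: "linear_hypergraph (c_star r)"
  unfolding linear_hypergraph_def c_star_def snd_conv
  by (intro ballI impI card_le_1I; elim insertE UnE imageE; hypsubst?)
     (auto simp del: Times_Int_Times)

end

(* Call a vertex small if its degree is at most m^2 + 1, where m = r - 1, and let every small
   vertex distribute total weight 1 among its edges; it suffices that each edge receives at least
   m / (m^2 - 1). Disjoint edges through the vertices of an edge e can be chosen greedily in order
   of increasing degree, so crown-freeness gives an i < r with d(v_i) <= i m + 1. If e has a vertex
   that is not small then i < m, and the i + 1 vertices of lowest degree already give e enough
   weight under uniform distribution. If e has only small vertices, it receives at least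
   (m + 1) / (m^2 + 1), which is enough for r >= 4.

   For r = 3 this fails exactly for edges whose degrees are (4,5,5) or (5,5,5). Around such a bad
   edge, crown-freeness forces two Fano planes sharing that edge, possibly with one line missing,
   and all other vertices of these planes have degree at most 3. Hence the vertices of a bad edge
   can give it their whole weight: each of their other edges receives 1/3 from each of its two
   remaining vertices. *)
theory Submission
  imports Defs "HOL-Combinatorics.Permutations"
begin

section \<open>Crown-free linear hypergraphs: greedy choice of disjoint edges\<close>

text \<open>\<open>no_crown\<close> describes a crown by its transversal \<open>e\<close>, an
  enumeration \<open>p\<close> of \<open>e\<close> and one edge \<open>F i\<close> through each
  point. Disjointness already makes every \<open>F i\<close> differ from \<open>e\<close>, and
  linearity then makes it meet \<open>e\<close> only in \<open>p i\<close>.\<close>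

locale crown_free_linear =
  fixes E :: "'a set set" and r :: nat
  assumes r_ge_2: "r \<ge> 2"
    and finite_E: "finite E"
    and card_edge: "e \<in> E \<Longrightarrow> card e = r"
    and linear: "\<lbrakk>e \<in> E; f \<in> E; u \<in> e; u \<in> f; v \<in> e; v \<in> f; u \<noteq> v\<rbrakk> \<Longrightarrow> e = f"
    and no_crown: "\<lbrakk>e \<in> E; bij_betw p {..<r} e; \<And>i. i < r \<Longrightarrow> F i \<in> E; \<And>i. i < r \<Longrightarrow> p i \<in> F i;
        \<And>i j. i < j \<Longrightarrow> j < r \<Longrightarrow> F i \<inter> F j = {}\<rbrakk> \<Longrightarrow> False"
begin

definition star :: "'a \<Rightarrow> 'a set set" where "star v = {e \<in> E. v \<in> e}"

abbreviation deg :: "'a \<Rightarrow> nat" where "deg v \<equiv> card (star v)"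

lemma finite_star [simp]: "finite (star v)"
  using finite_E by (simp add: star_def)

lemma finite_edge: "e \<in> E \<Longrightarrow> finite e"
  using card_edge r_ge_2 by (metis card.infinite not_numeral_le_zero)

lemma deg_pos: "e \<in> E \<Longrightarrow> v \<in> e \<Longrightarrow> deg v > 0"
  using finite_E by (auto simp: card_gt_0_iff star_def)

text \<open>By linearity two edges through \<open>v\<close> share no second point, so points of
  \<open>T\<close> picked on different edges are different.\<close>

lemma representatives:
  assumes "A \<subseteq> star v" "v \<notin> T" "\<And>g. g \<in> A \<Longrightarrow> g \<inter> T \<noteq> {}"
  obtains h where "inj_on h A" "h ` A \<subseteq> T" "\<And>g. g \<in> A \<Longrightarrow> h g \<in> g"
proof -
  have "\<forall>g\<in>A. \<exists>t. t \<in> g \<inter> T" using assms(3) by blast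
  then obtain h where h: "\<And>g. g \<in> A \<Longrightarrow> h g \<in> g \<inter> T" by metis
  have "inj_on h A"
  proof (rule inj_onI)
    fix g g' assume g: "g \<in> A" "g' \<in> A" "h g = h g'"
    then have "v \<noteq> h g" using h assms(2) by blast
    then show "g = g'"
      using g h[of g] h[of g'] assms(1) by (intro linear[of g g' v "h g"]) (auto simp: star_def)
  qed
  then show thesis using that h by blast
qed

text \<open>Pigeonhole: each point of \<open>T\<close> lies on at most one edge through
  \<open>v\<close>.\<close>

lemma avoid:
  assumes "A \<subseteq> star v" "finite T" "v \<notin> T" "card T < card A"
  obtains g where "g \<in> A" "g \<inter> T = {}"
proof (rule ccontr)
  assume "\<not> thesis"
  then have "\<And>g. g \<in> A \<Longrightarrow> g \<inter> T \<noteq> {}" using that by blast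
  from representatives[OF assms(1,3) this] obtain h
    where "inj_on h A" "h ` A \<subseteq> T" .
  from card_inj_on_le[OF this assms(2)] show False using assms(4) by simp
qed

text \<open>Extremal counterpart of \<open>avoid\<close>: the injective choice of representatives
  must exhaust \<open>T\<close>, so incidence between \<open>A\<close> and \<open>T\<close> is a
  perfect matching.\<close>

lemma saturate:
  assumes "A \<subseteq> star v" "finite T" "v \<notin> T" "card T \<le> card A"
    and "\<And>g. g \<in> A \<Longrightarrow> g \<inter> T \<noteq> {}"
  shows "t \<in> T \<Longrightarrow> \<exists>g\<in>A. t \<in> g"
    and "g \<in> A \<Longrightarrow> t \<in> T \<Longrightarrow> t' \<in> T \<Longrightarrow> t \<in> g \<Longrightarrow> t' \<in> g \<Longrightarrow> t = t'"
proof -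
  from representatives[OF assms(1,3,5)] obtain h
    where h: "inj_on h A" "h ` A \<subseteq> T" "\<And>g. g \<in> A \<Longrightarrow> h g \<in> g" by blast
  have T: "h ` A = T"
    using h(1,2) assms(2,4) by (intro card_seteq) (simp_all add: card_image)
  show "t \<in> T \<Longrightarrow> \<exists>g\<in>A. t \<in> g" using h(3) T by blast
  have *: "t = h g" if "g \<in> A" "t \<in> T" "t \<in> g" for g t
  proof -
    obtain g' where g': "g' \<in> A" "t = h g'" using T \<open>t \<in> T\<close> by blast
    then have "g = g'"
      using that h(3)[of g'] assms(1,3) by (intro linear[of g g' v t]) (auto simp: star_def)
    then show ?thesis using g' by simp
  qed
  show "g \<in> A \<Longrightarrow> t \<in> T \<Longrightarrow> t' \<in> T \<Longrightarrow> t \<in> g \<Longrightarrow> t' \<in> g \<Longrightarrow> t = t'"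
    using *[of g t] *[of g t'] by simp
qed

lemma divide_le_divide_cross:
  fixes a b c d :: real
  assumes "a * d \<le> c * b" "b > 0" "d > 0"
  shows "a / b \<le> c / d"
  using assms by (simp add: pos_divide_le_eq pos_le_divide_eq)

text \<open>Contrapositive, by greedy construction: the \<open>k\<close> edges already chosen have
  at most \<open>k * (r - 1)\<close> points off \<open>e\<close>, each blocking at most one of the
  more than \<open>k * (r - 1)\<close> edges other than \<open>e\<close> through \<open>v k\<close>.
  The enumeration is arbitrary here; it is sorted by degree only in applications.\<close>

lemma low_degree_vertex:
  assumes e: "e \<in> E" and v: "bij_betw v {..<r} e"
  shows "\<exists>i<r. deg (v i) \<le> i * (r - 1) + 1"
proof (rule ccontr)
  assume "\<not> ?thesis"
  then have big: "deg (v i) > i * (r - 1) + 1" if "i < r" for i using that by force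
  have ve: "v i \<in> e" if "i < r" for i using that v by (auto simp: bij_betw_def)
  have vinj: "v i \<noteq> v j" if "i < j" "j < r" for i j
    using that v by (auto simp: bij_betw_def inj_on_def)
  have only: "g \<inter> e = {v i}" if "g \<in> star (v i) - {e}" "i < r" for g i
    using that ve[of i] linear[OF e, of g "v i"] by (auto simp: star_def)
  have "k \<le> r \<Longrightarrow> \<exists>F. (\<forall>i<k. F i \<in> star (v i) - {e}) \<and> (\<forall>j<k. \<forall>i<j. F i \<inter> F j = {})" for k
  proof (induction k)
    case (Suc k)
    then obtain F where F: "\<And>i. i < k \<Longrightarrow> F i \<in> star (v i) - {e}"
      "\<And>i j. j < k \<Longrightarrow> i < j \<Longrightarrow> F i \<inter> F j = {}" by (metis Suc_leD)
    \<comment> \<open>The points \<open>v i\<close> can be left out, since an edge through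
      \<open>v k\<close> other than \<open>e\<close> meets \<open>e\<close> only in
      \<open>v k\<close>.\<close>
    define T where "T = (\<Union>i<k. F i - {v i})"
    have FE: "F i \<in> E" if "i < k" for i using F(1)[OF that] by (simp add: star_def)
    have "card T \<le> (\<Sum>i<k. card (F i - {v i}))" unfolding T_def by (rule card_UN_le) simp
    also have "\<dots> = (\<Sum>i<k. r - 1)"
    proof (rule sum.cong[OF refl])
      fix i assume "i \<in> {..<k}"
      then have "i < k" by simp
      then show "card (F i - {v i}) = r - 1"
        using F(1)[of i] card_edge[OF FE] finite_edge[OF FE] by (simp add: star_def)
    qed
    finally have "card T \<le> k * (r - 1)" by simp
    moreover have "card (star (v k) - {e}) = deg (v k) - 1"
      using e ve[of k] Suc.prems by (intro card_Diff_singleton) (simp add: star_def)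
    ultimately have "card T < card (star (v k) - {e})" using big[of k] Suc.prems by simp
    moreover have Te: "T \<inter> e = {}"
      using only F(1) Suc.prems unfolding T_def by fastforce
    moreover have "finite T" unfolding T_def using finite_edge FE by blast
    ultimately obtain g where g: "g \<in> star (v k) - {e}" "g \<inter> T = {}"
      using avoid[of "star (v k) - {e}" "v k" T] ve[of k] Suc.prems by auto
    have "F i \<inter> g = {}" if "i < k" for i
    proof -
      have "v i \<notin> g" using only[OF g(1)] ve[of i] vinj[of i k] that Suc.prems by auto
      then show ?thesis using g(2) that unfolding T_def by blast
    qed
    then show ?case
      using F g(1) by (intro exI[of _ "F(k := g)"]) (auto simp: less_Suc_eq)
  qed simp
  from this[of r] obtain F where "\<And>i. i < r \<Longrightarrow> F i \<in> star (v i) - {e}"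
    "\<And>i j. j < r \<Longrightarrow> i < j \<Longrightarrow> F i \<inter> F j = {}" by (metis order_refl)
  then show False using no_crown[OF e v, of F] by (auto simp: star_def)
qed

lemma sorted_enumeration:
  assumes "e \<in> E"
  obtains v where "bij_betw v {..<r} e" "\<And>i j. i \<le> j \<Longrightarrow> j < r \<Longrightarrow> deg (v i) \<le> deg (v j)"
proof -
  obtain xs where xs: "set xs = e" "distinct xs"
    using finite_distinct_list[OF finite_edge[OF assms]] by blast
  define ys where "ys = sort_key deg xs"
  have ys: "set ys = e" "distinct ys" "sorted (map deg ys)" using xs by (simp_all add: ys_def)
  have len: "length ys = r" using card_edge[OF assms] distinct_card[OF ys(2)] ys(1) by simp
  show thesis
  proof (rule that[of "\<lambda>i. ys ! i"])
    show "bij_betw ((!) ys) {..<r} e" using bij_betw_nth[OF ys(2)] len ys(1) by blast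
    show "deg (ys ! i) \<le> deg (ys ! j)" if "i \<le> j" "j < r" for i j
      using sorted_nth_mono[OF ys(3) that(1)] that len by simp
  qed
qed

section \<open>Vertex weights and the edge bound for \<open>r\<close> at least 4\<close>

definition small :: "'a set" where "small = {v. deg v < (r - 1)\<^sup>2 + 2}"

lemma weight_of_edge_with_big_vertex:
  assumes r: "r \<ge> 3" and e: "e \<in> E" and "\<not> e \<subseteq> small"
  shows "(\<Sum>v\<in>e. if v \<in> small then 1 / real (deg v) else 0) \<ge> (real r - 1) / (real r * (real r - 2))"
proof -
  obtain v where v: "bij_betw v {..<r} e"
    and mono: "\<And>i j. i \<le> j \<Longrightarrow> j < r \<Longrightarrow> deg (v i) \<le> deg (v j)"
    using sorted_enumeration[OF e] by blast
  obtain i where i: "i < r" "deg (v i) \<le> i * (r - 1) + 1"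
    using low_degree_vertex[OF e v] by blast
  have ve: "v i \<in> e" if "i < r" for i using that v by (auto simp: bij_betw_def)
  obtain j where j: "j < r" "v j \<notin> small" using assms(3) v by (auto simp: bij_betw_def)
  \<comment> \<open>Otherwise \<open>v i\<close> has the highest degree on \<open>e\<close>, and
    this is at most \<open>(r - 1)^2 + 1\<close>, so all of \<open>e\<close> would be small.\<close>
  have "i \<noteq> r - 1"
  proof
    assume "i = r - 1"
    then have "deg (v j) \<le> deg (v i)" using mono[of j i] j(1) i(1) by simp
    then have "deg (v j) \<le> (r - 1)\<^sup>2 + 1" using i(2) \<open>i = r - 1\<close> by (simp add: power2_eq_square)
    then show False using j(2) by (simp add: small_def)
  qed
  then have i': "i + 2 \<le> r" using i(1) by simp
  have low: "deg (v k) \<le> i * (r - 1) + 1" if "k \<le> i" for k using mono[OF that i(1)] i(2) by simp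
  have "i * (r - 1) \<le> (r - 1)\<^sup>2" using i' by (simp add: power2_eq_square)
  then have low_small: "v k \<in> small" if "k \<le> i" for k using low[OF that] by (simp add: small_def)
  have pos: "real r - 1 > 0" "real r * (real r - 2) > 0" using r by simp_all
  define m where "m = real r - 1"
  have m: "m \<ge> 2" "real i \<le> m - 1" using r i' by (simp_all add: m_def)
  \<comment> \<open>Cross-multiplied form of m / (m^2 - 1) <= (i + 1) / (i m + 1); here m^2 - 1 = r
    (r - 2).\<close>
  have "m * (real i * m + 1) \<le> (real i + 1) * (m\<^sup>2 - 1)"
  proof -
    have "(real i + 1) * (m\<^sup>2 - 1) - m * (real i * m + 1) = (m - 1 - real i) + m * (m - 2)"
      by (simp add: algebra_simps power2_eq_square)
    moreover have "m * (m - 2) \<ge> 0" using m by simp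
    ultimately show ?thesis using m(2) by linarith
  qed
  moreover have "m\<^sup>2 - 1 = real r * (real r - 2)" by (simp add: m_def algebra_simps power2_eq_square)
  ultimately have "m / (real r * (real r - 2)) \<le> (real i + 1) / (real i * m + 1)"
    using m pos(2) by (intro divide_le_divide_cross) (simp_all add: add_nonneg_pos)
  also have "(real i + 1) / (real i * m + 1) = (\<Sum>k\<le>i. 1 / (real i * m + 1))" by simp
  also have "\<dots> \<le> (\<Sum>k\<le>i. 1 / real (deg (v k)))"
  proof (rule sum_mono)
    fix k assume "k \<in> {..i}"
    then have k: "k \<le> i" by simp
    have "real (deg (v k)) \<le> real (i * (r - 1) + 1)" using low[OF k] by (simp only: of_nat_le_iff)
    also have "\<dots> = real i * m + 1" using r by (simp add: m_def of_nat_diff)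
    finally show "1 / (real i * m + 1) \<le> 1 / real (deg (v k))"
      using deg_pos[OF e ve, of k] k i(1) by (intro divide_left_mono) auto
  qed
  also have "\<dots> = (\<Sum>k\<le>i. if v k \<in> small then 1 / real (deg (v k)) else 0)"
    using low_small by simp
  also have "\<dots> \<le> (\<Sum>k<r. if v k \<in> small then 1 / real (deg (v k)) else 0)"
    using i(1) by (intro sum_mono2) auto
  also have "\<dots> = (\<Sum>v\<in>e. if v \<in> small then 1 / real (deg v) else 0)"
    by (rule sum.reindex_bij_betw[OF v])
  finally show ?thesis by (simp add: m_def)
qed

text \<open>Double counting, with \<open>c v e\<close> read as the weight that \<open>v\<close>
  gives to \<open>e\<close>.\<close>

lemma edge_count:
  assumes "finite V" "\<And>e. e \<in> E \<Longrightarrow> e \<subseteq> V"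
    and "\<And>e. e \<in> E \<Longrightarrow> (\<Sum>v\<in>e. c v e) \<ge> (\<kappa>::real)"
    and "\<And>v. v \<in> V \<Longrightarrow> (\<Sum>e\<in>star v. c v e) \<le> (if v \<in> small then 1 else 0)"
  shows "\<kappa> * card E \<le> card (V \<inter> small)"
proof -
  have "\<kappa> * card E = (\<Sum>e\<in>E. \<kappa>)" by simp
  also have "\<dots> \<le> (\<Sum>e\<in>E. \<Sum>v\<in>e. c v e)" using assms(3) by (rule sum_mono)
  also have "\<dots> = (\<Sum>e\<in>E. \<Sum>v | v \<in> V \<and> v \<in> e. c v e)"
    using assms(2) by (intro sum.cong refl) auto
  also have "\<dots> = (\<Sum>v\<in>V. \<Sum>e\<in>star v. c v e)"
    unfolding star_def using finite_E assms(1) by (rule sum.swap_restrict)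
  also have "\<dots> \<le> (\<Sum>v\<in>V. if v \<in> small then 1 else 0)" using assms(4) by (rule sum_mono)
  also have "\<dots> = card (V \<inter> small)"
    using assms(1) by (simp add: sum.If_cases)
  finally show ?thesis .
qed

lemma sum_star_inverse_deg: "(\<Sum>e\<in>star v. 1 / real (deg v)) \<le> 1"
  by simp

lemma edge_bound_ge_4:
  assumes r: "r \<ge> 4" and V: "finite V" "\<And>e. e \<in> E \<Longrightarrow> e \<subseteq> V"
  shows "(real r - 1) / (real r * (real r - 2)) * card E \<le> card (V \<inter> small)"
proof (rule edge_count[OF V])
  fix e assume e: "e \<in> E"
  show "(\<Sum>v\<in>e. if v \<in> small then 1 / real (deg v) else 0) \<ge> (real r - 1) / (real r * (real r - 2))"
  proof (cases "e \<subseteq> small")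
    case True
    define m where "m = real r - 1"
    have m: "m \<ge> 3" using r by (simp add: m_def)
    \<comment> \<open>For m = 2 this difference is -1, so \<open>r = 3\<close> needs another
      weighting.\<close>
    have "(m + 1) * (m\<^sup>2 - 1) - m * (m\<^sup>2 + 1) = (m - 3) * (m + 1) + 2"
      by (simp add: algebra_simps power2_eq_square)
    moreover have "(m - 3) * (m + 1) \<ge> 0" using m by simp
    ultimately have "m * (m\<^sup>2 + 1) \<le> (m + 1) * (m\<^sup>2 - 1)" by linarith
    moreover have "m\<^sup>2 - 1 = real r * (real r - 2)" by (simp add: m_def algebra_simps power2_eq_square)
    moreover have "real r * (real r - 2) > 0" using r by simp
    ultimately have "m / (real r * (real r - 2)) \<le> (m + 1) / (m\<^sup>2 + 1)"
      by (simp add: field_simps add_pos_nonneg)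
    also have "\<dots> = (\<Sum>v\<in>e. 1 / (m\<^sup>2 + 1))" using card_edge[OF e] by (simp add: m_def)
    also have "\<dots> \<le> (\<Sum>v\<in>e. if v \<in> small then 1 / real (deg v) else 0)"
    proof (rule sum_mono)
      fix v assume v: "v \<in> e"
      then have "v \<in> small" using True by blast
      then have "deg v \<le> (r - 1)\<^sup>2 + 1" by (simp add: small_def)
      then have "real (deg v) \<le> real ((r - 1)\<^sup>2 + 1)" by (simp only: of_nat_le_iff)
      also have "\<dots> = m\<^sup>2 + 1" using r by (simp add: m_def of_nat_diff)
      finally show "1 / (m\<^sup>2 + 1) \<le> (if v \<in> small then 1 / real (deg v) else 0)"
        using deg_pos[OF e v] \<open>v \<in> small\<close> by (auto intro!: divide_left_mono)
    qed
    finally show ?thesis by (simp add: m_def)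
  next
    case False
    then show ?thesis using weight_of_edge_with_big_vertex[OF _ e] r by simp
  qed
next
  fix v
  show "(\<Sum>e\<in>star v. if v \<in> small then 1 / real (deg v) else 0) \<le> (if v \<in> small then 1 else 0)"
    using sum_star_inverse_deg by simp
qed

end

section \<open>Linear triple systems without a crown\<close>

locale crown_free_triple_system = crown_free_linear E 3 for E :: "'a set set"
begin

lemma triple_distinct: "{a, b, c} \<in> E \<Longrightarrow> a \<noteq> b \<and> a \<noteq> c \<and> b \<noteq> c"
  by (drule card_edge) (auto simp: card_insert_if split: if_splits)

lemma third_unique: "{y, a, c} \<in> E \<Longrightarrow> {y, a, d} \<in> E \<Longrightarrow> c = d"
proof -
  assume E: "{y, a, c} \<in> E" "{y, a, d} \<in> E"
  have "y \<noteq> a" "c \<noteq> y" "c \<noteq> a" using triple_distinct[OF E(1)] by auto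
  moreover have "{y, a, c} = {y, a, d}" by (rule linear[OF E, of y a]) (use calculation in simp_all)
  ultimately show "c = d" by blast
qed

lemma edge_through:
  assumes "e \<in> E" "x \<in> e"
  obtains a b where "e = {x, a, b}"
proof -
  have "card (e - {x}) = 2" using card_edge[OF assms(1)] assms(2) by simp
  then obtain a b where "e - {x} = {a, b}" by (auto simp: card_2_iff)
  then show thesis using that[of a b] assms(2) by blast
qed

lemma no_crown_triple:
  assumes "{x, y, z} \<in> E" "f \<in> E" "g \<in> E" "h \<in> E" "x \<in> f" "y \<in> g" "z \<in> h"
    and "f \<inter> g = {}" "f \<inter> h = {}" "g \<inter> h = {}"
  shows False
proof (rule no_crown[OF assms(1), of "(!) [x, y, z]" "(!) [f, g, h]"])
  show "bij_betw ((!) [x, y, z]) {..<3} {x, y, z}"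
    using triple_distinct[OF assms(1)] by (intro bij_betw_nth) auto
qed (use assms in \<open>auto simp: less_Suc_eq numeral_3_eq_3 disjoint_iff\<close>)

end

section \<open>Local structure around a bad edge\<close>

text \<open>The lower bound on \<open>deg x\<close> covers both degree patterns (4,5,5) and (5,5,5);
  the upper bound is added in \<open>bad\<close>.\<close>

locale bad_edge = crown_free_triple_system +
  fixes x y z
  assumes xyz: "{x, y, z} \<in> E" and deg_x: "deg x \<ge> 4" and deg_y: "deg y = 5" and deg_z: "deg z = 5"
begin

text \<open>Transfers statements about \<open>Z\<close> to \<open>Y\<close> and conversely.\<close>

lemma bad_edge_swap: "bad_edge E x z y"
  by unfold_locales (use xyz deg_x deg_y deg_z in \<open>simp_all add: insert_commute\<close>)

abbreviation X where "X \<equiv> star x - {{x, y, z}}"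
abbreviation Y where "Y \<equiv> star y - {{x, y, z}}"
abbreviation Z where "Z \<equiv> star z - {{x, y, z}}"

lemma cards: "card X \<ge> 3" "card Y = 4" "card Z = 4"
proof -
  have "{x, y, z} \<in> star x" "{x, y, z} \<in> star y" "{x, y, z} \<in> star z"
    using xyz by (auto simp: star_def)
  then show "card X \<ge> 3" "card Y = 4" "card Z = 4"
    using deg_x deg_y deg_z by (simp_all add: card_Diff_singleton)
qed

lemma once:
  assumes "g \<in> E" "g \<noteq> {x, y, z}" "u \<in> g" "v \<in> g" "u \<in> {x, y, z}" "v \<in> {x, y, z}"
  shows "u = v"
  using linear[OF assms(1) xyz assms(3,5,4,6)] assms(2) by blast

lemma xyz_distinct: "x \<noteq> y" "x \<noteq> z" "y \<noteq> z"
  using triple_distinct[OF xyz] by auto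

lemma star_memD:
  shows "g \<in> X \<Longrightarrow> g \<in> E \<and> x \<in> g \<and> y \<notin> g \<and> z \<notin> g"
    and "g \<in> Y \<Longrightarrow> g \<in> E \<and> y \<in> g \<and> x \<notin> g \<and> z \<notin> g"
    and "g \<in> Z \<Longrightarrow> g \<in> E \<and> z \<in> g \<and> x \<notin> g \<and> y \<notin> g"
  using once[of g x y] once[of g x z] once[of g y z] xyz_distinct by (auto simp: star_def)

text \<open>Without a crown, each of the four edges in \<open>Z\<close> meets the at most four points of \<open>p \<union> q\<close> off
  the bad edge, so these incidences form a perfect matching.\<close>

lemma saturated:
  assumes p: "p \<in> X" and q: "q \<in> Y" and pq: "p \<inter> q = {}"
  defines "T \<equiv> (p - {x}) \<union> (q - {y})"
  shows "t \<in> T \<Longrightarrow> \<exists>k\<in>Z. t \<in> k"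
    and "k \<in> Z \<Longrightarrow> t \<in> T \<Longrightarrow> t' \<in> T \<Longrightarrow> t \<in> k \<Longrightarrow> t' \<in> k \<Longrightarrow> t = t'"
proof -
  note pD = star_memD(1)[OF p] and qD = star_memD(2)[OF q]
  have A: "Z \<subseteq> star z" by blast
  have fin: "finite T" using pD qD finite_edge by (simp add: T_def)
  have "card T \<le> card (p - {x}) + card (q - {y})" unfolding T_def by (rule card_Un_le)
  then have c: "card T \<le> card Z" using pD qD by (simp add: card_edge cards)
  have z: "z \<notin> T" using pD qD by (simp add: T_def)
  have meet: "k \<inter> T \<noteq> {}" if k: "k \<in> Z" for k
  proof
    assume "k \<inter> T = {}"
    then have "p \<inter> k = {}" "q \<inter> k = {}" using star_memD(3)[OF k] by (auto simp: T_def)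
    then show False
      using no_crown_triple[OF xyz, of p q k] pD qD star_memD(3)[OF k] pq by blast
  qed
  show "t \<in> T \<Longrightarrow> \<exists>k\<in>Z. t \<in> k"
    and "k \<in> Z \<Longrightarrow> t \<in> T \<Longrightarrow> t' \<in> T \<Longrightarrow> t \<in> k \<Longrightarrow> t' \<in> k \<Longrightarrow> t = t'"
    using saturate[OF A fin z c meet] by blast+
qed

text \<open>The two points of \<open>p\<close> other than \<open>x\<close> meet at most two of the
  four edges in \<open>Y\<close>, so some \<open>q\<close> in \<open>Y\<close> is disjoint from
  \<open>p\<close> and \<open>saturated\<close> applies.\<close>

lemma X_covered_by_Z:
  assumes p: "p \<in> X" and "a \<in> p" "a \<noteq> x"
  shows "\<exists>k\<in>Z. a \<in> k"
proof -
  note pD = star_memD(1)[OF p]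
  obtain q where q: "q \<in> Y" "q \<inter> (p - {x}) = {}"
    using avoid[of Y y "p - {x}"] pD finite_edge[of p] card_edge[of p] cards by auto
  then have "p \<inter> q = {}" using star_memD(2)[of q] by blast
  from saturated(1)[OF p q(1) this, of a] show ?thesis using assms by blast
qed

text \<open>As before with \<open>X\<close> and \<open>Y\<close> exchanged: three edges in
  \<open>X\<close> against two points, which is what \<open>deg x \<ge> 4\<close> provides.\<close>

lemma Y_covered_by_Z:
  assumes q: "q \<in> Y" and "a \<in> q" "a \<noteq> y"
  shows "\<exists>k\<in>Z. a \<in> k"
proof -
  note qD = star_memD(2)[OF q]
  obtain p where p: "p \<in> X" "p \<inter> (q - {y}) = {}"
    using avoid[of X x "q - {y}"] qD finite_edge[of q] card_edge[of q] cards by auto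
  then have "p \<inter> q = {}" using star_memD(1)[of p] by blast
  from saturated(1)[OF p(1) q this, of a] show ?thesis using assms by blast
qed

lemma X_covered_by_Y: "p \<in> X \<Longrightarrow> a \<in> p \<Longrightarrow> a \<noteq> x \<Longrightarrow> \<exists>q\<in>Y. a \<in> q"
  and Z_covered_by_Y: "k \<in> Z \<Longrightarrow> a \<in> k \<Longrightarrow> a \<noteq> z \<Longrightarrow> \<exists>q\<in>Y. a \<in> q"
  using bad_edge.X_covered_by_Z[OF bad_edge_swap, of p a]
    bad_edge.Y_covered_by_Z[OF bad_edge_swap, of k a]
  by (simp_all add: insert_commute)

text \<open>In the union of the links of \<open>x\<close>, \<open>y\<close> and \<open>z\<close>, coloured by these three vertices, a block is
  a properly coloured \<open>K\<^sub>4\<close> on \<open>a, b, c, d\<close> from which the \<open>x\<close>-coloured edge \<open>c d\<close> may be missing.\<close>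

definition block :: "'a \<Rightarrow> 'a \<Rightarrow> 'a \<Rightarrow> 'a \<Rightarrow> bool" where
  "block a b c d \<longleftrightarrow> a \<notin> {x, y, z} \<and> {x, a, b} \<in> E \<and> {y, a, c} \<in> E \<and> {y, b, d} \<in> E \<and>
    {z, a, d} \<in> E \<and> {z, b, c} \<in> E"

lemma outside:
  assumes "{u, a, b} \<in> E" "u \<in> {x, y, z}" "a \<notin> {x, y, z}"
  shows "b \<notin> {x, y, z}" "{u, a, b} \<noteq> {x, y, z}"
proof -
  show *: "{u, a, b} \<noteq> {x, y, z}" using assms(3) by blast
  show "b \<notin> {x, y, z}"
  proof
    assume "b \<in> {x, y, z}"
    from once[OF assms(1) * _ _ assms(2) this] have "u = b" by simp
    then show False using triple_distinct[OF assms(1)] by simp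
  qed
qed

text \<open>Let \<open>t\<close> be the third point of the edge through \<open>z\<close> and
  \<open>a\<close>. The \<open>Y\<close>-edge through \<open>t\<close> must meet
  \<open>{x, a, b}\<close>, since otherwise \<open>{z, a, t}\<close> would be matched to both
  \<open>a\<close> and \<open>t\<close> in \<open>saturated\<close>. Linearity excludes
  \<open>a\<close>, so it passes through \<open>b\<close>, and \<open>t = d\<close>.\<close>

lemma opposite_edge:
  assumes p: "{x, a, b} \<in> E" and a: "a \<notin> {x, y, z}"
  shows "\<exists>c d. {y, a, c} \<in> E \<and> {y, b, d} \<in> E \<and> {z, a, d} \<in> E"
proof -
  have b: "b \<notin> {x, y, z}" "{x, a, b} \<noteq> {x, y, z}" using outside[OF p _ a] by auto
  have pX: "{x, a, b} \<in> X" using p b by (simp add: star_def)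
  obtain q where q: "q \<in> Y" "a \<in> q" using X_covered_by_Y[OF pX, of a] a by blast
  then obtain c where c: "q = {y, a, c}" using star_memD(2)[of q] a by (auto elim!: edge_through[of q y])
  obtain q' where q': "q' \<in> Y" "b \<in> q'" using X_covered_by_Y[OF pX, of b] b by blast
  then obtain d where d: "q' = {y, b, d}" using star_memD(2)[of q'] b by (auto elim!: edge_through[of q' y])
  obtain k where k: "k \<in> Z" "a \<in> k" using X_covered_by_Z[OF pX, of a] a by blast
  then obtain t where t: "k = {z, a, t}" using star_memD(3)[of k] a by (auto elim!: edge_through[of k z])
  have kE: "{z, a, t} \<in> E" and qE: "{y, a, c} \<in> E" "{y, b, d} \<in> E"
    using star_memD q q' k t c d by auto
  have t': "t \<noteq> z" "t \<noteq> a" using triple_distinct[OF kE] by auto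
  obtain q'' where q'': "q'' \<in> Y" "t \<in> q''" using Z_covered_by_Y[OF k(1), of t] t t' by blast
  then have ty: "t \<noteq> y" "t \<noteq> x" using outside[OF kE _ a] by auto
  have "{x, a, b} \<inter> q'' \<noteq> {}"
    using saturated(2)[OF pX q''(1) _ k(1), of a t] q'' t t' ty a by auto
  then have "a \<in> q'' \<or> b \<in> q''" using star_memD(2)[OF q''(1)] by auto
  moreover have "a \<notin> q''"
  proof
    assume "a \<in> q''"
    then have "{z, a, t} = q''"
      using q''(2) t'(2) star_memD(2)[OF q''(1)] by (intro linear[OF kE, of q'' a t]) auto
    then show False using star_memD(2)[OF q''(1)] by blast
  qed
  ultimately have "b \<in> q''" by blast
  then have "q'' = {y, b, d}"
    using star_memD(2)[OF q''(1)] b(1) by (intro linear[OF _ qE(2), of q'' y b]) auto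
  then have "t \<in> {y, b, d}" using q''(2) by blast
  moreover have "t \<noteq> b"
  proof
    assume "t = b"
    then have "{z, a, t} = {x, a, b}" using t' by (intro linear[OF kE p, of a b]) auto
    then have "z \<in> {x, a, b}" by blast
    then show False using a b(1) xyz_distinct by auto
  qed
  ultimately have "t = d" using ty by simp
  then show ?thesis using kE qE by blast
qed

text \<open>Apply \<open>opposite_edge\<close> from both ends of the pair \<open>a\<close>,
  \<open>b\<close>; the points found agree because two points determine the edge.\<close>

lemma block_exists:
  assumes p: "{x, a, b} \<in> E" and a: "a \<notin> {x, y, z}"
  obtains c d where "block a b c d"
proof -
  have b: "b \<notin> {x, y, z}" using outside[OF p _ a] by simp
  obtain c d where 1: "{y, a, c} \<in> E" "{y, b, d} \<in> E" "{z, a, d} \<in> E"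
    using opposite_edge[OF p a] by blast
  obtain c' d' where 2: "{y, b, c'} \<in> E" "{y, a, d'} \<in> E" "{z, b, d'} \<in> E"
    using opposite_edge[of b a] p b by (auto simp: insert_commute)
  have "d' = c" using third_unique 1(1) 2(2) by blast
  then show thesis using that[of c d] 1 2 p a by (simp add: block_def)
qed

lemma block_outside: "block a b c d \<Longrightarrow> {a, b, c, d} \<inter> {x, y, z} = {}"
  using outside[of x a b] outside[of y a c] outside[of z a d] by (auto simp: block_def)

lemma block_swap: "block a b c d \<Longrightarrow> block b a d c"
  using block_outside[of a b c d] by (auto simp: block_def insert_commute)

lemma block_distinct:
  assumes B: "block a b c d"
  shows "distinct [a, b, c, d]"
proof -
  have E: "{x, a, b} \<in> E" "{y, a, c} \<in> E" "{y, b, d} \<in> E" "{z, a, d} \<in> E" "{z, b, c} \<in> E"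
    using B by (simp_all add: block_def)
  have "c \<noteq> d"
  proof
    assume "c = d"
    then have "{y, c, a} \<in> E" "{y, c, b} \<in> E" using E by (simp_all add: insert_commute)
    then have "a = b" by (rule third_unique)
    then show False using triple_distinct[OF E(1)] by simp
  qed
  then show ?thesis using E[THEN triple_distinct] by auto
qed

text \<open>The block built on \<open>{x, c, u}\<close> also uses the edge \<open>{z, c, b}\<close>,
  so its \<open>y\<close>-edge through \<open>u\<close> contains \<open>b\<close> and equals
  \<open>{y, b, d}\<close>.\<close>

lemma block_closed:
  assumes B: "block a b c d" and u: "{x, c, u} \<in> E"
  shows "u = d"
proof -
  have "c \<notin> {x, y, z}" using block_outside[OF B] by blast
  from block_exists[OF u this] obtain c' d' where B': "block c u c' d'" .
  have "{y, c, a} \<in> E" "{z, c, b} \<in> E" "{y, b, d} \<in> E"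
    using B by (simp_all add: block_def insert_commute)
  moreover have "{y, c, c'} \<in> E" "{z, c, d'} \<in> E" "{y, u, d'} \<in> E"
    using B' by (simp_all add: block_def)
  ultimately show ?thesis
    using third_unique[of z c b d'] third_unique[of y b d u] by (auto simp: insert_commute)
qed

lemma X_edge_meets_block:
  assumes B: "block a b c d" and g: "g \<in> X" "g \<inter> {a, b, c, d} \<noteq> {}"
  shows "g = {x, a, b} \<or> g = {x, c, d}"
proof -
  note gD = star_memD(1)[OF g(1)]
  have out: "{a, b, c, d} \<inter> {x, y, z} = {}" by (rule block_outside[OF B])
  obtain w where w: "w \<in> g" "w \<in> {a, b, c, d}" using g(2) by blast
  then have "w \<noteq> x" using out by auto
  then obtain u where u: "g = {x, w, u}" using gD w(1) by (auto elim!: edge_through[of g x])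
  have uE: "{x, w, u} \<in> E" using gD u by simp
  have "{x, a, b} \<in> E" "{x, b, a} \<in> E" using B by (simp_all add: block_def insert_commute)
  from w(2) consider "w = a" | "w = b" | "w = c" | "w = d" by blast
  then show ?thesis
  proof cases
    case 1
    then show ?thesis using third_unique[OF \<open>{x, a, b} \<in> E\<close>, of u] uE u by simp
  next
    case 2
    then show ?thesis using third_unique[OF \<open>{x, b, a} \<in> E\<close>, of u] uE u by auto
  next
    case 3
    then show ?thesis using block_closed[OF B, of u] uE u by simp
  next
    case 4
    then show ?thesis using block_closed[OF block_swap[OF B], of u] uE u by auto
  qed
qed

section \<open>Two Fano planes sharing the bad edge\<close>

text \<open>The bad edge, the first block and \<open>{x, c, d}\<close> form a Fano plane. The second
  plane may lack its line \<open>{x, s, t}\<close>, as happens when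
  \<open>deg x = 4\<close>.\<close>

definition two_planes where
  "two_planes a b c d p q s t \<longleftrightarrow> block a b c d \<and> {x, c, d} \<in> E \<and> block p q s t \<and>
     {a, b, c, d} \<inter> {p, q, s, t} = {} \<and> \<Union>Y = {y, a, b, c, d, p, q, s, t}"

text \<open>An \<open>X\<close>-edge off the first block starts a disjoint second one, and the four
  \<open>y\<close>-edges of the blocks exhaust \<open>Y\<close>. A third \<open>X\<close>-edge is
  covered by \<open>Y\<close>, so it meets one of the blocks and completes it.\<close>

lemma two_planes_exist: "\<exists>a b c d p q s t. two_planes a b c d p q s t"
proof -
  have X_diff: "\<exists>g\<in>X. g \<noteq> g1 \<and> g \<noteq> g2" for g1 g2
  proof (rule ccontr)
    assume "\<not> ?thesis"
    then have "X \<subseteq> {g1, g2}" by blast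
    then have "card X \<le> card {g1, g2}" by (intro card_mono) auto
    also have "\<dots> \<le> 2" by (simp add: card_insert_if)
    finally show False using cards(1) by simp
  qed
  have X_form: "\<exists>a b. g = {x, a, b} \<and> a \<notin> {x, y, z}" if "g \<in> X" for g
  proof -
    note gD = star_memD(1)[OF that]
    then obtain a b where ab: "g = {x, a, b}" using edge_through by metis
    then show ?thesis using gD triple_distinct[of x a b] by auto
  qed
  obtain g1 where g1: "g1 \<in> X" using X_diff by blast
  obtain a b where ab: "g1 = {x, a, b}" "a \<notin> {x, y, z}" using X_form[OF g1] by blast
  obtain c d where B: "block a b c d" using block_exists[of a b] ab star_memD(1)[OF g1] by blast
  obtain g2 where g2: "g2 \<in> X" "g2 \<noteq> {x, a, b}" "g2 \<noteq> {x, c, d}" using X_diff by blast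
  obtain p q where pq: "g2 = {x, p, q}" "p \<notin> {x, y, z}" using X_form[OF g2(1)] by blast
  obtain s t where B': "block p q s t" using block_exists[of p q] pq star_memD(1)[OF g2(1)] by blast
  have disj_pq: "g2 \<inter> {a, b, c, d} = {}" using X_edge_meets_block[OF B g2(1)] g2 by blast
  have Yedges: "{y, a, c} \<in> E" "{y, b, d} \<in> E" "{y, p, s} \<in> E" "{y, q, t} \<in> E"
    using B B' by (simp_all add: block_def)
  have out: "{a, b, c, d} \<inter> {x, y, z} = {}" "{p, q, s, t} \<inter> {x, y, z} = {}"
    using block_outside B B' by auto
  have dist: "distinct [a, b, c, d]" "distinct [p, q, s, t]"
    using block_distinct B B' by auto
  have disj: "{a, b, c, d} \<inter> {p, q, s, t} = {}"
  proof -
    \<comment> \<open>The \<open>y\<close>-edges at \<open>a\<close>, \<open>b\<close>,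
      \<open>c\<close>, \<open>d\<close> stay inside the first block, so one that has a point
      \<open>v\<close> outside ends outside.\<close>
    have *: "u \<notin> {a, b, c, d}" if "{y, v, u} \<in> E" "v \<notin> {a, b, c, d}" for u v
      using that Yedges(1,2) third_unique[of y u v a] third_unique[of y u v b]
        third_unique[of y u v c] third_unique[of y u v d]
      by (auto simp: insert_commute)
    have "p \<notin> {a, b, c, d}" "q \<notin> {a, b, c, d}" using disj_pq pq by auto
    then show ?thesis using *[of p s] *[of q t] Yedges by blast
  qed
  have Y: "{{y, a, c}, {y, b, d}, {y, p, s}, {y, q, t}} = Y" (is "?Y = _")
  proof (rule card_seteq)
    show "?Y \<subseteq> Y" using Yedges out by (auto simp: star_def)
    have "a \<notin> {y, b, d} \<union> {y, p, s} \<union> {y, q, t}" "b \<notin> {y, p, s} \<union> {y, q, t}" "p \<notin> {y, q, t}"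
      using dist disj out by auto
    then have "{y, a, c} \<notin> {{y, b, d}, {y, p, s}, {y, q, t}}"
      "{y, b, d} \<notin> {{y, p, s}, {y, q, t}}" "{y, p, s} \<noteq> {y, q, t}" by blast+
    then have "card ?Y = 4" by simp
    then show "card Y \<le> card ?Y" using cards by simp
  qed simp
  have UY: "\<Union>Y = {y, a, b, c, d, p, q, s, t}" unfolding Y[symmetric] by auto
  obtain g3 where g3: "g3 \<in> X" "g3 \<noteq> {x, a, b}" "g3 \<noteq> {x, p, q}" using X_diff by blast
  obtain u v where uv: "g3 = {x, u, v}" "u \<notin> {x, y, z}" using X_form[OF g3(1)] by blast
  have "u \<in> \<Union>Y" using X_covered_by_Y[OF g3(1), of u] uv by auto
  then have "g3 \<inter> {a, b, c, d} \<noteq> {} \<or> g3 \<inter> {p, q, s, t} \<noteq> {}" using uv UY by auto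
  then have "g3 = {x, c, d} \<or> g3 = {x, s, t}"
    using X_edge_meets_block[OF B g3(1)] X_edge_meets_block[OF B' g3(1)] g3(2,3) by metis
  then have "{x, c, d} \<in> E \<or> {x, s, t} \<in> E" using star_memD(1)[OF g3(1)] by auto
  then show ?thesis
  proof
    assume "{x, c, d} \<in> E"
    then have "two_planes a b c d p q s t" unfolding two_planes_def using B B' disj UY by blast
    then show ?thesis by blast
  next
    \<comment> \<open>The completed block has to come first, so the two blocks trade places.\<close>
    assume "{x, s, t} \<in> E"
    moreover have "\<Union>Y = {y, p, q, s, t, a, b, c, d}" unfolding UY by auto
    ultimately have "two_planes p q s t a b c d" unfolding two_planes_def using B B' disj by blast
    then show ?thesis by blast
  qed
qed

text \<open>These relabelings carry \<open>a\<close> to \<open>b\<close>, \<open>c\<close> and,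
  composed, \<open>d\<close>, and carry \<open>p\<close>, \<open>s\<close> to \<open>q\<close>,
  \<open>t\<close>; closure then needs checking only at \<open>a\<close>, \<open>p\<close> and
  \<open>s\<close>.\<close>

lemma two_planes_sym:
  assumes "two_planes a b c d p q s t"
  shows "two_planes b a d c p q s t" "two_planes c d a b p q s t" "two_planes a b c d q p t s"
proof -
  have B: "block a b c d" "{x, c, d} \<in> E" "block p q s t" using assms by (simp_all add: two_planes_def)
  have "c \<notin> {x, y, z}" using block_outside[OF B(1)] by blast
  then have B': "block c d a b" using B by (simp add: block_def insert_commute)
  have "{x, a, b} \<in> E" "{x, d, c} \<in> E" using B by (simp_all add: block_def insert_commute)
  then show "two_planes b a d c p q s t" "two_planes c d a b p q s t" "two_planes a b c d q p t s"
    using assms B' block_swap[OF B(1)] block_swap[OF B(3)] unfolding two_planes_def by blast+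
qed

text \<open>If \<open>a\<close> were in \<open>f\<close>, crowns with transversals through
  \<open>a\<close> would force \<open>f\<close> to meet all pairs of the second block except
  possibly \<open>s\<close>, \<open>t\<close>. Linearity allows only one point of each such pair,
  which is impossible on the triangle \<open>p\<close>, \<open>q\<close>, \<open>s\<close>.\<close>

lemma first_plane_closed:
  assumes P: "two_planes a b c d p q s t" and f: "f \<in> E" "f \<inter> {x, y, z} = {}"
  shows "a \<notin> f"
proof
  assume a: "a \<in> f"
  have B: "block a b c d" "{x, c, d} \<in> E" "block p q s t" using P by (simp_all add: two_planes_def)
  have E: "{x, a, b} \<in> E" "{y, a, c} \<in> E" "{z, a, d} \<in> E" "{y, b, d} \<in> E" "{z, b, c} \<in> E"
    "{x, p, q} \<in> E" "{y, p, s} \<in> E" "{y, q, t} \<in> E" "{z, p, t} \<in> E" "{z, q, s} \<in> E"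
    using B by (simp_all add: block_def)
  have dist: "distinct [a, b, c, d]" "distinct [p, q, s, t]" using B block_distinct by auto
  have out: "{a, b, c, d} \<inter> {x, y, z} = {}" "{p, q, s, t} \<inter> {x, y, z} = {}"
    using block_outside B by auto
  have disj: "{a, b, c, d} \<inter> {p, q, s, t} = {}" using P by (simp add: two_planes_def)
  have notin: "w \<notin> f" if "{v, a, w} \<in> E" "v \<in> {x, y, z}" for v w
    using linear[OF that(1) f(1), of a w] triple_distinct[OF that(1)] that a f(2) by auto
  have bcd: "b \<notin> f" "c \<notin> f" "d \<notin> f" using notin E by auto
  \<comment> \<open>The transversal is \<open>{k, a, l}\<close>, with \<open>{k, u, v}\<close> at
    \<open>k\<close>, \<open>f\<close> at \<open>a\<close> and \<open>{k', l, m}\<close> at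
    \<open>l\<close>.\<close>
  have meet: "f \<inter> {u, v} \<noteq> {}"
    if k: "{k, a, l} \<in> E" "{k, u, v} \<in> E" "{k', l, m} \<in> E" and kk: "k \<in> {x, y, z}" "k' \<in> {x, y, z}" "k \<noteq> k'"
      and lm: "l \<in> {b, c, d}" "m \<in> {b, c, d}" and uv: "{u, v} \<subseteq> {p, q, s, t}" for k k' l m u v
  proof
    assume "f \<inter> {u, v} = {}"
    then have "{k, u, v} \<inter> f = {}" "f \<inter> {k', l, m} = {}" using f(2) bcd kk lm by auto
    moreover have "{k, u, v} \<inter> {k', l, m} = {}"
      using uv lm kk disj out by auto
    ultimately show False using no_crown_triple[OF k(1) k(2) f(1) k(3)] a by blast
  qed
  have "f \<inter> {p, q} \<noteq> {}" by (rule meet[of x b p q y d]) (use E xyz_distinct in auto)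
  moreover have "f \<inter> {p, s} \<noteq> {}" by (rule meet[of y c p s x d]) (use E B xyz_distinct in auto)
  moreover have "f \<inter> {q, t} \<noteq> {}" by (rule meet[of y c q t x d]) (use E B xyz_distinct in auto)
  moreover have "f \<inter> {p, t} \<noteq> {}"
    by (rule meet[of z d p t x c]) (use E B xyz_distinct in \<open>auto simp: insert_commute\<close>)
  moreover have "f \<inter> {q, s} \<noteq> {}"
    by (rule meet[of z d q s x c]) (use E B xyz_distinct in \<open>auto simp: insert_commute\<close>)
  moreover have "\<not> (u \<in> f \<and> w \<in> f)" if "{v, u, w} \<in> E" "v \<in> {x, y, z}" for u v w
    using linear[OF that(1) f(1), of u w] triple_distinct[OF that(1)] that f(2) by auto
  then have "\<not> (p \<in> f \<and> q \<in> f)" "\<not> (p \<in> f \<and> s \<in> f)" "\<not> (q \<in> f \<and> t \<in> f)"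
    "\<not> (p \<in> f \<and> t \<in> f)" "\<not> (q \<in> f \<and> s \<in> f)" using E by blast+
  ultimately show False by blast
qed

text \<open>The second plane is treated separately because \<open>{x, s, t}\<close> may be missing:
  the crowns for \<open>p\<close> and \<open>s\<close> use \<open>{y, a, c}\<close> and lines of the
  second block that are present.\<close>

lemma planes_closed:
  assumes P: "two_planes a b c d p q s t" and f: "f \<in> E" "f \<inter> {x, y, z} = {}"
  shows "f \<inter> {a, b, c, d, p, q, s, t} = {}"
proof -
  have abcd: "f \<inter> {a, b, c, d} = {}"
    using first_plane_closed[OF P f] first_plane_closed[OF two_planes_sym(1)[OF P] f]
      first_plane_closed[OF two_planes_sym(2)[OF P] f]
      first_plane_closed[OF two_planes_sym(1)[OF two_planes_sym(2)[OF P]] f] by blast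
  have ps: "p \<notin> f \<and> s \<notin> f" if P: "two_planes a b c d p q s t" for p q s t
  proof -
    have B: "block a b c d" "block p q s t" using P by (simp_all add: two_planes_def)
    have E: "{y, p, s} \<in> E" "{y, s, p} \<in> E" "{y, a, c} \<in> E" "{z, s, q} \<in> E" "{x, p, q} \<in> E"
      using B by (simp_all add: block_def insert_commute)
    have out: "{a, b, c, d} \<inter> {x, y, z} = {}" "{p, q, s, t} \<inter> {x, y, z} = {}"
      using block_outside B by auto
    have disj: "{a, b, c, d} \<inter> {p, q, s, t} = {}" using P by (simp add: two_planes_def)
    have only: "\<not> (u \<in> f \<and> w \<in> f)" if "{v, u, w} \<in> E" "v \<in> {x, y, z}" for u v w
      using linear[OF that(1) f(1), of u w] triple_distinct[OF that(1)] that f(2) by auto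
    have not_both: "\<not> (p \<in> f \<and> s \<in> f)" "\<not> (s \<in> f \<and> q \<in> f)" "\<not> (p \<in> f \<and> q \<in> f)"
      using only E by blast+
    have ac: "{y, a, c} \<inter> f = {}" "{y, a, c} \<inter> {z, s, q} = {}" "{y, a, c} \<inter> {x, p, q} = {}"
      using abcd f(2) disj out xyz_distinct by auto
    have "p \<notin> f"
    proof
      assume "p \<in> f"
      then have "f \<inter> {z, s, q} = {}" using not_both f(2) by auto
      then show False
        using no_crown_triple[OF E(1) E(3) f(1) E(4)] \<open>p \<in> f\<close> ac by blast
    qed
    moreover have "s \<notin> f"
    proof
      assume "s \<in> f"
      then have "f \<inter> {x, p, q} = {}" using not_both f(2) by auto
      then show False
        using no_crown_triple[OF E(2) E(3) f(1) E(5)] \<open>s \<in> f\<close> ac by blast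
    qed
    ultimately show ?thesis by blast
  qed
  show ?thesis using abcd ps[OF P] ps[OF two_planes_sym(3)[OF P]] by blast
qed

text \<open>Such a \<open>v\<close> lies in the two planes, so each of its edges meets the bad edge,
  and different edges meet it in different points.\<close>

lemma deg_neighbour_le_3:
  assumes g: "g \<in> E" "g \<noteq> {x, y, z}" "g \<inter> {x, y, z} \<noteq> {}" and v: "v \<in> g" "v \<notin> {x, y, z}"
  shows "deg v \<le> 3"
proof -
  obtain a b c d p q s t where P: "two_planes a b c d p q s t" using two_planes_exist by blast
  have "g \<in> X \<or> g \<in> Y \<or> g \<in> Z" using g by (auto simp: star_def)
  then have "v \<in> \<Union>Y" using X_covered_by_Y[of g v] Z_covered_by_Y[of g v] v by auto
  then have vW: "v \<in> {a, b, c, d, p, q, s, t}" using P v(2) by (auto simp: two_planes_def)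
  have "f \<inter> {x, y, z} \<noteq> {}" if "f \<in> star v" for f
    using planes_closed[OF P, of f] that vW by (auto simp: star_def)
  from representatives[OF subset_refl v(2) this] obtain h where
    "inj_on h (star v)" "h ` star v \<subseteq> {x, y, z}" .
  then have "deg v \<le> card {x, y, z}" by (intro card_inj_on_le) auto
  also have "\<dots> = 3" using card_edge[OF xyz] .
  finally show ?thesis .
qed

end

section \<open>Redistributed weights and the edge bound for \<open>r = 3\<close>\<close>

context crown_free_triple_system
begin

text \<open>The bound \<open>deg x \<le> 5\<close> makes all three vertices small, so each has
  weight 1 to give.\<close>

definition bad :: "'a set set" where
  "bad = {e. \<exists>x y z. e = {x, y, z} \<and> bad_edge E x y z \<and> deg x \<le> 5}"

lemma bad_in_E: "e \<in> bad \<Longrightarrow> e \<in> E"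
  by (auto simp: bad_def dest: bad_edge.xyz)

lemma deg_bad: "e \<in> bad \<Longrightarrow> v \<in> e \<Longrightarrow> 4 \<le> deg v \<and> deg v \<le> 5"
  by (auto simp: bad_def dest: bad_edge.deg_x bad_edge.deg_y bad_edge.deg_z)

lemma deg_neighbour_of_bad:
  assumes "e \<in> bad" "g \<in> E" "g \<noteq> e" "g \<inter> e \<noteq> {}" "v \<in> g" "v \<notin> e"
  shows "deg v \<le> 3"
proof -
  obtain x y z where e: "e = {x, y, z}" "bad_edge E x y z" using assms(1) by (auto simp: bad_def)
  show ?thesis using bad_edge.deg_neighbour_le_3[OF e(2) assms(2)] assms(3-6) e(1) by simp
qed

text \<open>A vertex of \<open>f\<close> off \<open>e\<close> would have degree at most 3 as a
  neighbour of \<open>e\<close>, but at least 4 as a vertex of \<open>f\<close>.\<close>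

lemma bad_edge_unique:
  assumes "e \<in> bad" "f \<in> bad" "v \<in> e" "v \<in> f"
  shows "e = f"
proof (rule ccontr)
  assume "e \<noteq> f"
  have "\<not> f \<subseteq> e"
    using \<open>e \<noteq> f\<close> card_subset_eq[of e f] card_edge bad_in_E assms(1,2) finite_edge by metis
  then obtain u where u: "u \<in> f" "u \<notin> e" by blast
  then have "deg u \<le> 3"
    using deg_neighbour_of_bad[OF assms(1) bad_in_E[OF assms(2)], of u] \<open>e \<noteq> f\<close> assms by blast
  then show False using deg_bad[OF assms(2) u(1)] by simp
qed

lemma small_iff: "v \<in> small \<longleftrightarrow> deg v \<le> 5"
  by (auto simp: small_def)

definition weight :: "'a \<Rightarrow> 'a set \<Rightarrow> real" where
  "weight v e = (if v \<in> \<Union>bad then if e \<in> bad then 1 else 0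
     else if v \<in> small then 1 / deg v else 0)"

lemma weight_vertex: "(\<Sum>e\<in>star v. weight v e) \<le> (if v \<in> small then 1 else 0)"
proof (cases "v \<in> \<Union>bad")
  case True
  then obtain e where e: "e \<in> bad" "v \<in> e" by blast
  have "f \<in> bad \<longleftrightarrow> f = e" if "f \<in> star v" for f
    using bad_edge_unique[OF _ e(1) _ e(2), of f] that e(1) by (auto simp: star_def)
  then have "(\<Sum>f\<in>star v. weight v f) = (\<Sum>f\<in>star v. if f = e then 1 else 0)"
    using True by (intro sum.cong) (auto simp: weight_def)
  also have "\<dots> \<le> 1" by simp
  finally show ?thesis using deg_bad[OF e] by (simp add: small_iff)
next
  case False
  then show ?thesis using sum_star_inverse_deg[of v] by (simp add: weight_def)
qed

lemma weight_nonneg: "weight v e \<ge> 0"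
  by (simp add: weight_def)

lemma weight_deg_le:
  assumes "e \<in> E" "v \<in> e" "v \<notin> \<Union>bad" "deg v \<le> k" "k \<le> 5"
  shows "weight v e \<ge> 1 / real k"
  using assms deg_pos[OF assms(1,2)] by (auto simp: weight_def small_iff intro!: divide_left_mono)

lemma weight_edge:
  assumes e: "e \<in> E"
  shows "(\<Sum>v\<in>e. weight v e) \<ge> 2 / 3"
proof -
  \<comment> \<open>A bad edge receives 3. A near edge receives nothing from the shared vertex and
    at least 1/3 from each of the other two. A far edge sees only uniform weights.\<close>
  consider (bad) "e \<in> bad" | (near) f where "e \<notin> bad" "f \<in> bad" "e \<inter> f \<noteq> {}"
    | (far) "e \<notin> bad" "e \<inter> \<Union>bad = {}" by blast
  then show ?thesis
  proof cases
    case bad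
    then have "(\<Sum>v\<in>e. weight v e) = (\<Sum>v\<in>e. 1)"
      by (intro sum.cong) (auto simp: weight_def)
    then show ?thesis using card_edge[OF e] by simp
  next
    case near
    then obtain x where x: "x \<in> e" "x \<in> f" by blast
    then obtain u w where uw: "e = {x, u, w}" using edge_through[OF e] by metis
    have "e \<noteq> f" using near by blast
    have dist: "x \<noteq> u" "x \<noteq> w" "u \<noteq> w" using triple_distinct[of x u w] e uw by auto
    have third: "weight v e \<ge> 1 / 3" if "v \<in> e" "v \<noteq> x" for v
    proof -
      have "v \<notin> f" using linear[OF e bad_in_E[OF near(2)], of x v] that x \<open>e \<noteq> f\<close> by blast
      then have "deg v \<le> 3"
        using deg_neighbour_of_bad[OF near(2) e \<open>e \<noteq> f\<close> near(3) that(1)] by simp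
      moreover from this have "v \<notin> \<Union>bad" using deg_bad[of _ v] by fastforce
      ultimately show ?thesis using weight_deg_le[OF e that(1), of 3] by simp
    qed
    have "(\<Sum>v\<in>e. weight v e) = weight x e + weight u e + weight w e"
      using dist by (simp add: uw)
    moreover have "weight u e \<ge> 1 / 3" "weight w e \<ge> 1 / 3" using third uw dist by auto
    ultimately show ?thesis using weight_nonneg[of x e] by simp
  next
    case far
    show ?thesis
    proof (cases "e \<subseteq> small")
      case False
      have "(\<Sum>v\<in>e. weight v e) = (\<Sum>v\<in>e. if v \<in> small then 1 / real (deg v) else 0)"
        using far by (intro sum.cong) (auto simp: weight_def)
      then show ?thesis using weight_of_edge_with_big_vertex[OF _ e False] by simp
    next
      case True
      obtain v :: "nat \<Rightarrow> 'a" where v: "bij_betw v {..<3} e"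
        and mono: "\<And>i j. i \<le> j \<Longrightarrow> j < 3 \<Longrightarrow> deg (v i) \<le> deg (v j)"
        by (rule sorted_enumeration[OF e], rule that, assumption, simp)
      have set3: "{..<3::nat} = {0, 1, 2}" by auto
      have ve: "e = {v 0, v 1, v 2}" using v by (auto simp: bij_betw_def set3)
      have sum: "(\<Sum>v\<in>e. weight v e) = weight (v 0) e + weight (v 1) e + weight (v 2) e"
        using sum.reindex_bij_betw[OF v, of "\<lambda>u. weight u e"] by (simp add: set3)
      have le5: "deg (v 0) \<le> 5" "deg (v 1) \<le> 5" "deg (v 2) \<le> 5"
        using True ve small_iff by auto
      have w: "weight (v i) e \<ge> 1 / real k" if "i \<in> {0, 1, 2}" "deg (v i) \<le> k" "k \<le> 5" for i k
        using weight_deg_le[OF e, of "v i" k] far that ve by auto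
      have "\<not> bad_edge E (v 0) (v 1) (v 2)" using far(1) ve le5(1) by (auto simp: bad_def)
      then have "\<not> (deg (v 0) \<ge> 4 \<and> deg (v 1) = 5 \<and> deg (v 2) = 5)"
        using e ve crown_free_triple_system_axioms
        by (simp add: bad_edge_def bad_edge_axioms_def)
      \<comment> \<open>The two cases give at least 1/3 + 1/5 + 1/5 = 11/15 and 1/4 + 1/4 + 1/5 =
        7/10, both above 2/3.\<close>
      then consider "deg (v 0) \<le> 3" | "deg (v 0) \<le> 4" "deg (v 1) \<le> 4"
        using mono[of 0 1] mono[of 1 2] le5 by fastforce
      then show ?thesis
      proof cases
        case 1
        then show ?thesis using w[of 0 3] w[of 1 5] w[of 2 5] le5 sum by simp
      next
        case 2
        then show ?thesis using w[of 0 4] w[of 1 4] w[of 2 5] le5 sum by simp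
      qed
    qed
  qed
qed

lemma edge_bound_3:
  assumes "finite V" "\<And>e. e \<in> E \<Longrightarrow> e \<subseteq> V"
  shows "2 / 3 * card E \<le> card (V \<inter> small)"
  using edge_count[OF assms weight_edge weight_vertex] .

end

section \<open>Passage from hypergraph copies to the locale, and the final bound\<close>

text \<open>Row \<open>i\<close> of the grid is mapped onto \<open>F i\<close> with its column-0
  cell going to \<open>v i\<close>, so that column 0 is mapped onto \<open>e\<close>.\<close>

lemma contains_crownI:
  assumes e: "e \<in> edges G" and v: "bij_betw v {..<r} e"
    and F: "\<And>i. i < r \<Longrightarrow> F i \<in> edges G" "\<And>i. i < r \<Longrightarrow> v i \<in> F i"
      "\<And>i j. i < j \<Longrightarrow> j < r \<Longrightarrow> F i \<inter> F j = {}"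
    and G: "r_graph r G" and r: "r > 0"
  shows "contains_copy G (crown r)"
proof -
  have "\<exists>h. bij_betw h {..<r} (F i) \<and> h 0 = v i" if i: "i < r" for i
  proof -
    have c: "card (F i) = r" using F(1)[OF i] G by (simp add: r_graph_def)
    then have "finite (F i)" using r by (metis card.infinite less_numeral_extra(3))
    from ex_bij_betw_nat_finite[OF this] c obtain h where h: "bij_betw h {..<r} (F i)"
      by (auto simp: atLeast0LessThan)
    then obtain k where k: "k < r" "h k = v i"
      using F(2)[OF i] unfolding bij_betw_def by (metis imageE lessThan_iff)
    \<comment> \<open>Swapping 0 and \<open>k\<close> first moves \<open>v i\<close> to position
      0.\<close>
    have "bij_betw (h \<circ> transpose 0 k) {..<r} (F i)"
      using h k r by (intro bij_betw_trans[OF _ h] permutes_imp_bij permutes_swap_id) auto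
    then show ?thesis using k by (intro exI[of _ "h \<circ> transpose 0 k"]) simp
  qed
  then obtain h where h: "\<And>i. i < r \<Longrightarrow> bij_betw (h i) {..<r} (F i)" "\<And>i. i < r \<Longrightarrow> h i 0 = v i"
    by metis
  have im: "h i ` {..<r} = F i" if "i < r" for i using h(1)[OF that] by (simp add: bij_betw_def)
  have FV: "F i \<subseteq> verts G" if "i < r" for i using F(1)[OF that] G by (simp add: r_graph_def)
  define \<phi> where "\<phi> = (\<lambda>(i, j). h i j)"
  have disj: "F i \<inter> F j = {}" if "i \<noteq> j" "i < r" "j < r" for i j
    using F(3)[of i j] F(3)[of j i] that by (cases i j rule: linorder_cases) auto
  show ?thesis unfolding contains_copy_def
  proof (intro exI[of _ \<phi>] conjI ballI)
    show "inj_on \<phi> (verts (crown r))"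
    proof (rule inj_onI, clarsimp simp: crown_def \<phi>_def)
      fix i j i' j' assume a: "i < r" "j < r" "i' < r" "j' < r" "h i j = h i' j'"
      then have "h i j \<in> F i \<inter> F i'" using im[of i] im[of i'] by (metis IntI imageI lessThan_iff)
      then have "i = i'" using disj[of i i'] a by blast
      then show "i = i' \<and> j = j'" using a h(1)[of i] by (auto simp: bij_betw_def inj_on_def)
    qed
    show "\<phi> ` verts (crown r) \<subseteq> verts G"
      using im FV by (fastforce simp: crown_def \<phi>_def)
    fix f assume "f \<in> edges (crown r)"
    then consider "f = {..<r} \<times> {0}" | i where "i < r" "f = {i} \<times> {..<r}"
      by (auto simp: crown_def)
    then show "\<phi> ` f \<in> edges G"
    proof cases
      case 1
      have "\<phi> ` f = v ` {..<r}" using h(2) unfolding 1 \<phi>_def by (force simp: image_iff)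
      then show ?thesis using v e by (simp add: bij_betw_def)
    next
      case (2 i)
      have "\<phi> ` f = h i ` {..<r}" unfolding 2 \<phi>_def by (force simp: image_iff)
      then show ?thesis using im F(1) 2 by simp
    qed
  qed
qed

theorem theorem2p1:
  fixes r n s :: nat and G :: "'a hypergraph"
  assumes "r \<ge> 3"
    and "r_graph r G"
    and "linear_hypergraph G"
    and "free_of {crown r, c_star r} G"
    and "n = card (verts G)"
    and "s = card {v \<in> verts G. degree G v \<ge> (r - 1)\<^sup>2 + 2}"
  shows "real (card (edges G)) \<le> real r * (real r - 2) * (real n - real s) / (real r - 1)"
proof -
  have fin: "finite (verts G)" and sub: "\<And>e. e \<in> edges G \<Longrightarrow> e \<subseteq> verts G"
    and card: "\<And>e. e \<in> edges G \<Longrightarrow> card e = r"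
    using assms(2) by (auto simp: r_graph_def)
  interpret crown_free_linear "edges G" r
  proof
    show "r \<ge> 2" using assms(1) by simp
    show "finite (edges G)" using fin sub by (meson PowI finite_Pow_iff finite_subset subsetI)
    show "card e = r" if "e \<in> edges G" for e using card that .
    show "e = f" if "e \<in> edges G" "f \<in> edges G" "u \<in> e" "u \<in> f" "v \<in> e" "v \<in> f" "u \<noteq> v" for e f u v
    proof (rule ccontr)
      assume "e \<noteq> f"
      then have "card (e \<inter> f) \<le> 1" using that assms(3) by (simp add: linear_hypergraph_def)
      moreover have "card {u, v} \<le> card (e \<inter> f)"
        using that sub fin by (intro card_mono) (auto intro: finite_subset)
      ultimately show False using that(7) by simp
    qed
    show False if "e \<in> edges G" "bij_betw v {..<r} e" "\<And>i. i < r \<Longrightarrow> F i \<in> edges G"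
      "\<And>i. i < r \<Longrightarrow> v i \<in> F i" "\<And>i j. i < j \<Longrightarrow> j < r \<Longrightarrow> F i \<inter> F j = {}" for e v F
      using contains_crownI[OF that assms(2)] assms(1,4) by (auto simp: free_of_def)
  qed
  \<comment> \<open>The vertices outside \<open>small\<close> are exactly those counted by
    \<open>s\<close>, which leaves \<open>n - s\<close> small ones.\<close>
  have "degree G v = deg v" for v by (simp add: degree_def star_def)
  then have "verts G \<inter> small = verts G - {v \<in> verts G. degree G v \<ge> (r - 1)\<^sup>2 + 2}"
    by (auto simp: small_def)
  then have "card (verts G \<inter> small) = n - s"
    using fin assms(5,6) by (simp add: card_Diff_subset)
  moreover have "s \<le> n" using fin assms(5,6) by (auto intro: card_mono)
  ultimately have ns: "real (card (verts G \<inter> small)) = real n - real s" by (simp add: of_nat_diff)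
  have "(real r - 1) / (real r * (real r - 2)) * card (edges G) \<le> card (verts G \<inter> small)"
  proof (cases "r = 3")
    case True
    have "crown_free_triple_system (edges G)"
      using crown_free_linear_axioms True by (simp add: crown_free_triple_system_def)
    from crown_free_triple_system.edge_bound_3[OF this fin sub] show ?thesis using True by simp
  next
    case False
    then show ?thesis using edge_bound_ge_4[OF _ fin sub] assms(1) by simp
  qed
  moreover have "real r - 1 > 0" "real r * (real r - 2) > 0" using assms(1) by simp_all
  ultimately show ?thesis by (simp add: ns field_simps)
qed

end
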